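(* Let $K$ and $J$ be sets, with $K$ nonempty, and let $f:K\times J\to(0,\infty)$ be a function. For $A,B\in J$ define $g_{AB}:K\to(0,\infty)$ by $g_{AB}(P)=\frac{f(P,A)}{f(P,B)}$. Suppose that the general extremum requirement holds, that is, $\sup_{P\in K}g_{AB}(P)<\infty$ for all $A,B\in J$. Then the function $d^s:J\times J\to[0,\infty)$ given by $$d^s(A,B)=\ln\frac{\sup_{P\in K}g_{AB}(P)}{\inf_{P\in K}g_{AB}(P)}$$ is a semidistance on $J$.
   Context: A function $d:J\times J\to[0,\infty)$ is called a semidistance on $J$ if: (1) $A=B$ implies $d(A,B)=0$; (2) $d$ is symmetric, i.e. $d(A,B)=d(B,A)$ for all $A,B\in J$; (3) $d$ satisfies the triangle inequality $d(A,C)\le d(A,B)+d(B,C)$ for all $A,B,C\in J$. Under the general extremum requirement, $\inf_{P\in K}g_{AB}(P)$ exists and equals $\left[\sup_{P\in K}g_{BA}(P)\right]^{-1}>0$, so $d^s$ is well defined. *)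

theory Defs
  imports Complex_Main
begin

definition semidistance_on :: "'j set \<Rightarrow> ('j \<Rightarrow> 'j \<Rightarrow> real) \<Rightarrow> bool" where
  "semidistance_on J d \<longleftrightarrow>
     (\<forall>A\<in>J. \<forall>B\<in>J. 0 \<le> d A B) \<and>
     (\<forall>A\<in>J. \<forall>B\<in>J. A = B \<longrightarrow> d A B = 0) \<and>
     (\<forall>A\<in>J. \<forall>B\<in>J. d A B = d B A) \<and>
     (\<forall>A\<in>J. \<forall>B\<in>J. \<forall>C\<in>J. d A C \<le> d A B + d B C)"

definition ratio :: "('k \<Rightarrow> 'j \<Rightarrow> real) \<Rightarrow> 'j \<Rightarrow> 'j \<Rightarrow> 'k \<Rightarrow> real" where
  "ratio f A B P = f P A / f P B"

definition general_extremum_requirement ::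
  "'k set \<Rightarrow> 'j set \<Rightarrow> ('k \<Rightarrow> 'j \<Rightarrow> real) \<Rightarrow> bool" where
  "general_extremum_requirement K J f \<longleftrightarrow> (\<forall>A\<in>J. \<forall>B\<in>J. bdd_above (ratio f A B ` K))"

(* SUP and INF are the conditional real operators. For nonempty K, positive f and A, B in J they
   are the true extrema under the general extremum requirement, which moreover makes the
   infimum positive. *)
definition dist_s :: "'k set \<Rightarrow> ('k \<Rightarrow> 'j \<Rightarrow> real) \<Rightarrow> 'j \<Rightarrow> 'j \<Rightarrow> real" where
  "dist_s K f A B = ln ((SUP P\<in>K. ratio f A B P) / (INF P\<in>K. ratio f A B P))"

end

theory Submission imports Defs begin

text \<open>
  Write \<open>M A B\<close> for the supremum of \<open>f P A / f P B\<close> over \<open>K\<close>.  Since the ratio for \<open>(A, B)\<close> is the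
  reciprocal of the ratio for \<open>(B, A)\<close>, its infimum is \<open>1 / M B A\<close>, so the distance equals
  \<open>ln (M A B * M B A)\<close>.  In this form symmetry is evident, and the rest follows from two
  properties of \<open>M\<close>: \<open>M A A = 1\<close>, and \<open>M A C \<le> M A B * M B C\<close>, which comes from multiplying
  ratios pointwise.  The triangle inequality is the logarithm of the product of two instances of
  the latter.  Nonnegativity is the case \<open>C = A\<close>, which gives \<open>1 \<le> M A B * M B A\<close>.
\<close>

text \<open>Inversion reverses the order on the positive reals, and therefore exchanges extrema.\<close>

lemma cINF_inverse_eq_inverse_cSUP:
  fixes g :: "'k \<Rightarrow> real"
  assumes "K \<noteq> {}" and pos: "\<And>P. P \<in> K \<Longrightarrow> 0 < g P" and bdd: "bdd_above (g ` K)"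
  shows "(INF P\<in>K. inverse (g P)) = inverse (SUP P\<in>K. g P)"
proof (rule cInf_eq_non_empty)
  show "(\<lambda>P. inverse (g P)) ` K \<noteq> {}"
    using \<open>K \<noteq> {}\<close> by simp
next
  fix x assume "x \<in> (\<lambda>P. inverse (g P)) ` K"
  then show "inverse (SUP P\<in>K. g P) \<le> x"
    using pos cSUP_upper[OF _ bdd] by (auto intro!: le_imp_inverse_le)
next
  fix y assume lower: "\<And>x. x \<in> (\<lambda>P. inverse (g P)) ` K \<Longrightarrow> y \<le> x"
  obtain P0 where "P0 \<in> K" using \<open>K \<noteq> {}\<close> by blast
  then have sup_pos: "0 < (SUP P\<in>K. g P)"
    using pos cSUP_upper[OF _ bdd] by (meson less_le_trans)
  show "y \<le> inverse (SUP P\<in>K. g P)"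
  proof (cases "0 < y")
    case True
    have "(SUP P\<in>K. g P) \<le> inverse y"
    proof (rule cSUP_least[OF \<open>K \<noteq> {}\<close>])
      fix P assume "P \<in> K"
      then have "y \<le> inverse (g P)" using lower by blast
      then show "g P \<le> inverse y" using le_imp_inverse_le[OF _ True] by fastforce
    qed
    then show ?thesis using le_imp_inverse_le[OF _ sup_pos] by fastforce
  next
    case False
    then show ?thesis using sup_pos by (meson inverse_nonnegative_iff_nonnegative less_imp_le not_less order_trans)
  qed
qed

lemma cSUP_mult_le:
  fixes g h :: "'k \<Rightarrow> real"
  assumes "K \<noteq> {}" and nonneg: "\<And>P. P \<in> K \<Longrightarrow> 0 \<le> g P" "\<And>P. P \<in> K \<Longrightarrow> 0 \<le> h P"
    and bdd: "bdd_above (g ` K)" "bdd_above (h ` K)"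
  shows "(SUP P\<in>K. g P * h P) \<le> (SUP P\<in>K. g P) * (SUP P\<in>K. h P)"
proof (rule cSUP_least[OF \<open>K \<noteq> {}\<close>])
  fix P assume "P \<in> K"
  then have "0 \<le> g P" "g P \<le> (SUP P\<in>K. g P)" "0 \<le> h P" "h P \<le> (SUP P\<in>K. h P)"
    using nonneg cSUP_upper bdd by fast+
  then show "g P * h P \<le> (SUP P\<in>K. g P) * (SUP P\<in>K. h P)"
    by (intro mult_mono) linarith+
qed

theorem theorem3p1:
  fixes K :: "'k set" and J :: "'j set" and f :: "'k \<Rightarrow> 'j \<Rightarrow> real"
  assumes "K \<noteq> {}"
    and "\<forall>P\<in>K. \<forall>A\<in>J. 0 < f P A"
    and "general_extremum_requirement K J f"
  shows "semidistance_on J (dist_s K f)"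
proof -
  define M where "M A B = (SUP P\<in>K. ratio f A B P)" for A B
  have pos: "0 < ratio f A B P" if "A \<in> J" "B \<in> J" "P \<in> K" for A B P
    using assms(2) that by (simp add: ratio_def)
  have bdd: "bdd_above (ratio f A B ` K)" if "A \<in> J" "B \<in> J" for A B
    using assms(3) that by (simp add: general_extremum_requirement_def)
  have M_pos: "0 < M A B" if "A \<in> J" "B \<in> J" for A B
  proof -
    obtain P where "P \<in> K" using \<open>K \<noteq> {}\<close> by blast
    then show ?thesis
      unfolding M_def using pos cSUP_upper[OF _ bdd] that by (meson less_le_trans)
  qed
  have dist: "dist_s K f A B = ln (M A B * M B A)" if "A \<in> J" "B \<in> J" for A B
  proof -
    have "(INF P\<in>K. ratio f A B P) = (INF P\<in>K. inverse (ratio f B A P))"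
      by (simp add: ratio_def)
    also have "\<dots> = inverse (M B A)"
      unfolding M_def using that by (intro cINF_inverse_eq_inverse_cSUP \<open>K \<noteq> {}\<close> pos bdd)
    finally show ?thesis by (simp add: dist_s_def M_def divide_inverse)
  qed
  have M_refl: "M A A = 1" if "A \<in> J" for A
  proof -
    have "ratio f A A P = 1" if "P \<in> K" for P
      using pos[OF \<open>A \<in> J\<close> \<open>A \<in> J\<close> that] by (auto simp: ratio_def)
    then show ?thesis using \<open>K \<noteq> {}\<close> by (simp add: M_def)
  qed
  have M_mult: "M A C \<le> M A B * M B C" if "A \<in> J" "B \<in> J" "C \<in> J" for A B C
  proof -
    have "ratio f A C P = ratio f A B P * ratio f B C P" if "P \<in> K" for P
      using assms(2) \<open>P \<in> K\<close> \<open>B \<in> J\<close> by (force simp: ratio_def)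
    then have "M A C = (SUP P\<in>K. ratio f A B P * ratio f B C P)"
      by (simp add: M_def)
    also have "\<dots> \<le> M A B * M B C"
      unfolding M_def using that by (intro cSUP_mult_le \<open>K \<noteq> {}\<close> less_imp_le[OF pos] bdd)
    finally show ?thesis .
  qed
  show ?thesis
    unfolding semidistance_on_def
  proof (intro conjI ballI impI)
    fix A B assume "A \<in> J" "B \<in> J"
    then show "0 \<le> dist_s K f A B"
      using M_mult[of A B A] by (simp add: dist M_refl)
  next
    fix A B assume "A \<in> J" "B \<in> J" "A = B"
    then show "dist_s K f A B = 0"
      by (simp add: dist M_refl)
  next
    fix A B assume "A \<in> J" "B \<in> J"
    then show "dist_s K f A B = dist_s K f B A"
      by (simp add: dist mult.commute)
  next
    fix A B C assume J: "A \<in> J" "B \<in> J" "C \<in> J"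
    have "M A C * M C A \<le> (M A B * M B C) * (M C B * M B A)"
      using J by (intro mult_mono M_mult) (simp_all add: M_pos less_imp_le)
    also have "\<dots> = (M A B * M B A) * (M B C * M C B)"
      by (simp add: mult_ac)
    finally have "ln (M A C * M C A) \<le> ln ((M A B * M B A) * (M B C * M C B))"
      using J by (simp add: M_pos)
    also have "\<dots> = ln (M A B * M B A) + ln (M B C * M C B)"
      using J by (intro ln_mult_pos) (simp_all add: M_pos)
    finally show "dist_s K f A C \<le> dist_s K f A B + dist_s K f B C"
      using J by (simp add: dist)
  qed
qed

end
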